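(* Let $n$, $d$ and $k$ be positive integers such that $d\ge 2$ (and $d\le n/2$, so that the circulant graph $C_n(1,d)$ is defined). If $C$ is an identifying code in $C_n(1,d)$ with $k$ codewords, then there exists an identifying code in the infinite square grid $\mathcal{S}$ with density $k/n$. Analogously, if $C$ is a locating-dominating code in $C_n(1,d)$ with $k$ codewords, then there exists a locating-dominating code in $\mathcal{S}$ with density $k/n$; and if $C$ is a self-identifying code in $C_n(1,d)$ with $k$ codewords, then there exists a self-identifying code in $\mathcal{S}$ with density $k/n$.
   Context: All graphs are simple and undirected. For a graph $G=(V,E)$ and $u\in V$, $N[u]=\{u\}\cup\{v: uv\in E\}$ is the closed neighbourhood. A code is a nonempty subset $C\subseteq V$; its elements are codewords. The identifying set of $u$ is $I(C;u)=N[u]\cap C$. $C$ is dominating if $I(C;u)\neq\emptyset$ for all $u\in V$. $C$ is identifying if it is dominating and $I(C;u)\neq I(C;v)$ for all distinct $u,v\in V$. $C$ is locating-dominating if it is dominating and $I(C;u)\neq I(C;v)$ for all distinct $u,v\in V\setminus C$. $C$ is self-identifying if $I(C;u)\setminus I(C;v)\neq\emptyset$ for all distinct $u,v\in V$. For positive integers $n$ and $d_1,\dots,d_k\le n/2$, the circulant graph $C_n(d_1,\dots,d_k)$ has vertex set $\mathbb{Z}_n=\{0,\dots,n-1\}$, and the open neighbourhood of $u$ is $\{u\pm d_1,\dots,u\pm d_k\}$ (computed modulo $n$). The infinite square grid $\mathcal{S}$ has vertex set $\mathbb{Z}^2$, with $N[(x,y)]=\{(x',y')\in\mathbb{Z}^2: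 |x-x'|+|y-y'|\le 1\}$. With $Q_m=\{(x,y)\in\mathbb{Z}^2: |x|\le m, |y|\le m\}$, the density of a code $C\subseteq\mathbb{Z}^2$ is $D(C)=\limsup_{m\to\infty}|C\cap Q_m|/|Q_m|$. *)

theory Defs
  imports "HOL-Analysis.Analysis"
begin

record 'a ugraph =
  verts :: "'a set"
  edges :: "'a set set"

definition simple_graph :: "'a ugraph \<Rightarrow> bool" where
  "simple_graph G \<longleftrightarrow> (\<forall>e\<in>edges G. e \<subseteq> verts G \<and> card e = 2)"

definition closed_nbhd :: "'a ugraph \<Rightarrow> 'a \<Rightarrow> 'a set" where
  "closed_nbhd G u = {u} \<union> {v. {u, v} \<in> edges G}"

definition is_code :: "'a ugraph \<Rightarrow> 'a set \<Rightarrow> bool" where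
  "is_code G C \<longleftrightarrow> C \<noteq> {} \<and> C \<subseteq> verts G"

definition identifying_set :: "'a ugraph \<Rightarrow> 'a set \<Rightarrow> 'a \<Rightarrow> 'a set" where
  "identifying_set G C u = closed_nbhd G u \<inter> C"

definition dominating_code :: "'a ugraph \<Rightarrow> 'a set \<Rightarrow> bool" where
  "dominating_code G C \<longleftrightarrow>
     is_code G C \<and> (\<forall>u\<in>verts G. identifying_set G C u \<noteq> {})"

definition identifying_code :: "'a ugraph \<Rightarrow> 'a set \<Rightarrow> bool" where
  "identifying_code G C \<longleftrightarrow> dominating_code G C \<and>
     (\<forall>u\<in>verts G. \<forall>v\<in>verts G. u \<noteq> v \<longrightarrow>
        identifying_set G C u \<noteq> identifying_set G C v)"

definition locating_dominating_code :: "'a ugraph \<Rightarrow> 'a set \<Rightarrow> bool" where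
  "locating_dominating_code G C \<longleftrightarrow> dominating_code G C \<and>
     (\<forall>u\<in>verts G - C. \<forall>v\<in>verts G - C. u \<noteq> v \<longrightarrow>
        identifying_set G C u \<noteq> identifying_set G C v)"

definition self_identifying_code :: "'a ugraph \<Rightarrow> 'a set \<Rightarrow> bool" where
  "self_identifying_code G C \<longleftrightarrow> is_code G C \<and>
     (\<forall>u\<in>verts G. \<forall>v\<in>verts G. u \<noteq> v \<longrightarrow>
        identifying_set G C u - identifying_set G C v \<noteq> {})"

text \<open>The circulant graph \<open>C\<^sub>n(d\<^sub>1, \<dots>, d\<^sub>k)\<close> with \<open>D = {d\<^sub>1, \<dots>, d\<^sub>k}\<close>. It is meaningful only if
  every \<open>d \<in> D\<close> satisfies \<open>0 < d \<le> n / 2\<close>; this is not built into the definition.\<close>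

definition circulant :: "nat \<Rightarrow> nat set \<Rightarrow> int ugraph" where
  "circulant n D =
     \<lparr>verts = {0..<int n},
      edges = {{u, v} |u v. u \<in> {0..<int n} \<and>
        (\<exists>d\<in>D. v = (u + int d) mod int n \<or> v = (u - int d) mod int n)}\<rparr>"

definition square_grid :: "(int \<times> int) ugraph" where
  "square_grid =
     \<lparr>verts = UNIV,
      edges = {{(x, y), (x', y')} |x y x' y'. \<bar>x - x'\<bar> + \<bar>y - y'\<bar> = 1}\<rparr>"

definition grid_box :: "nat \<Rightarrow> (int \<times> int) set" where
  "grid_box m = {(x, y). \<bar>x\<bar> \<le> int m \<and> \<bar>y\<bar> \<le> int m}"

definition code_density :: "(int \<times> int) set \<Rightarrow> ereal" where
  "code_density C = limsup (\<lambda>m. ereal (real (card (C \<inter> grid_box m)) / real (card (grid_box m))))"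

lemma simple_graph_circulant:
  assumes "\<And>d. d \<in> D \<Longrightarrow> 0 < d \<and> 2 * d \<le> n"
  shows "simple_graph (circulant n D)"
proof -
  have "{u, v} \<subseteq> {0..<int n} \<and> card {u, v} = 2"
    if u: "u \<in> {0..<int n}" and d: "d \<in> D"
      and v: "v = (u + int d) mod int n \<or> v = (u - int d) mod int n" for u v d
  proof -
    have d': "0 < int d" "int d < int n" "0 < int n" using assms[OF d] by auto
    have "v \<noteq> u"
    proof
      assume "v = u"
      then have "u mod int n = (u + int d) mod int n \<or> u mod int n = (u - int d) mod int n"
        using u v by auto
      then have "int n dvd int d"
        by (auto simp: mod_eq_dvd_iff)
      then show False using d' zdvd_not_zless by blast
    qed
    moreover have "v \<in> {0..<int n}" using v d' by auto
    ultimately show ?thesis using u by auto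
  qed
  then show ?thesis
    unfolding simple_graph_def circulant_def by fastforce
qed

lemma closed_nbhd_circulant:
  assumes u: "u \<in> {0..<int n}"
  shows "closed_nbhd (circulant n D) u =
    {u} \<union> (\<Union>d\<in>D. {(u + int d) mod int n, (u - int d) mod int n})"
proof -
  have sym_step: "v = (u + int d) mod int n \<or> v = (u - int d) mod int n"
    if "v \<in> {0..<int n}" "u = (v + int d) mod int n \<or> u = (v - int d) mod int n" for v d
  proof -
    have "v mod int n = v" using that by simp
    then show ?thesis using that(2) by (auto simp: mod_simps)
  qed
  show ?thesis
    using u sym_step by (auto simp: closed_nbhd_def circulant_def doubleton_eq_iff; blast)
qed

lemma simple_graph_square_grid: "simple_graph square_grid"
  by (force simp: simple_graph_def square_grid_def card_insert_if)

lemma closed_nbhd_square_grid: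
  "closed_nbhd square_grid (x, y) = {(x', y'). \<bar>x - x'\<bar> + \<bar>y - y'\<bar> \<le> 1}"
proof -
  have "{(x, y), (x', y')} \<in> edges square_grid \<longleftrightarrow> \<bar>x - x'\<bar> + \<bar>y - y'\<bar> = 1" for x' y'
    by (auto simp: square_grid_def doubleton_eq_iff abs_minus_commute; blast)
  then show ?thesis
    by (auto simp: closed_nbhd_def)
qed

end

theory Submission
  imports Defs
begin

text \<open>The map \<open>\<phi>(x, y) = x + d y mod n\<close> sends every closed neighbourhood of the grid onto a closed
  neighbourhood of \<open>C\<^sub>n(1,d)\<close>, so pulling a code \<open>C\<close> back along \<open>\<phi>\<close> preserves domination and the
  separation of vertices with different images. Distinct vertices \<open>u\<close>, \<open>v\<close> with the same image share
  a neighbour only if \<open>n = 2d\<close> and \<open>v = u \<plusminus> (0, 2)\<close>; then the two vertical neighbours of \<open>u\<close> have the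
  same image, and so the one far from \<open>v\<close> is a codeword whenever the shared one is. The density
  is computed row by row, since each window of \<open>n\<close> consecutive points of a row is mapped bijectively
  onto the vertices of \<open>C\<^sub>n(1,d)\<close>.\<close>

section \<open>The map from the grid to the circulant graph and its action on neighbourhoods\<close>

definition grid_to_circulant :: "nat \<Rightarrow> nat \<Rightarrow> int \<times> int \<Rightarrow> int" where
  "grid_to_circulant n d = (\<lambda>(x, y). (x + int d * y) mod int n)"

lemma grid_to_circulant_simp [simp]:
  "grid_to_circulant n d (x, y) = (x + int d * y) mod int n"
  by (simp add: grid_to_circulant_def)

lemma grid_to_circulant_in_verts:
  "n > 0 \<Longrightarrow> grid_to_circulant n d p \<in> verts (circulant n D)"
  by (cases p) (simp add: circulant_def)

lemma verts_square_grid [simp]: "verts square_grid = UNIV"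
  by (simp add: square_grid_def)

lemma closed_nbhd_square_grid_explicit:
  "closed_nbhd square_grid (x, y) = {(x, y), (x + 1, y), (x - 1, y), (x, y + 1), (x, y - 1)}"
  unfolding closed_nbhd_square_grid by auto

text \<open>The map is additive modulo \<open>n\<close>: a horizontal unit step changes the image by
  1 and a vertical one by \<open>d\<close>, so the five points around \<open>p\<close> go exactly to
  the image of \<open>p\<close> and its translates by \<plusminus>1 and
  \<plusminus>\<open>d\<close>.\<close>

lemma grid_to_circulant_image_closed_nbhd:
  assumes "n > 0"
  shows "grid_to_circulant n d ` closed_nbhd square_grid p =
    closed_nbhd (circulant n {1, d}) (grid_to_circulant n d p)"
proof (cases p)
  case (Pair x y)
  have "(x + int d * y) mod int n \<in> {0..<int n}"
    using assms by simp
  then show ?thesis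
    unfolding Pair closed_nbhd_square_grid_explicit grid_to_circulant_simp
    by (simp add: closed_nbhd_circulant mod_simps algebra_simps insert_commute)
qed

text \<open>Membership in the pulled-back code depends only on the image of a point, so intersecting
  with the code commutes with taking images. Hence the identifying set of \<open>p\<close> in the
  grid determines that of its image.\<close>

lemma grid_to_circulant_image_identifying_set:
  assumes "n > 0"
  shows "grid_to_circulant n d ` identifying_set square_grid (grid_to_circulant n d -` C) p =
    identifying_set (circulant n {1, d}) C (grid_to_circulant n d p)"
  unfolding identifying_set_def grid_to_circulant_image_closed_nbhd[OF assms, symmetric] by auto

section \<open>Distinct grid vertices with the same image\<close>

lemma vertical_if_common_neighbour:
  assumes "d \<ge> 2" "2 * d \<le> n" and "u \<noteq> v"
    and "grid_to_circulant n d u = grid_to_circulant n d v"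
    and "w \<in> closed_nbhd square_grid u" "w \<in> closed_nbhd square_grid v"
  obtains x y s where "n = 2 * d" "s = 1 \<or> s = -1" "u = (x, y)" "v = (x, y + 2 * s)"
    "w = (x, y + s)"
proof -
  obtain a b a' b' where u: "u = (a, b)" and v: "v = (a', b')"
    by (cases u, cases v)
  \<comment> \<open>\<open>(i, j)\<close> is the displacement from \<open>u\<close> to
    \<open>v\<close>, and \<open>e\<close> is the resulting change of the image before reduction
    modulo \<open>n\<close>.\<close>
  define i j where "i = a' - a" and "j = b' - b"
  define e where "e = i + int d * j"
  have "int n dvd (a' + int d * b') - (a + int d * b)"
    using assms(4) unfolding u v by (simp add: mod_eq_dvd_iff dvd_diff_commute)
  then have dvd: "int n dvd e"
    by (simp add: e_def i_def j_def algebra_simps)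
  have "\<bar>i\<bar> + \<bar>j\<bar> \<le> 2" and ij: "i \<noteq> 0 \<or> j \<noteq> 0"
    using assms(3,5,6) unfolding u v i_def j_def
    by (cases w; simp add: closed_nbhd_square_grid; linarith)+
  then have "j = 0 \<and> \<bar>i\<bar> \<le> 2 \<or> \<bar>j\<bar> = 1 \<and> \<bar>i\<bar> \<le> 1 \<or> \<bar>j\<bar> = 2 \<and> i = 0"
    by linarith
  \<comment> \<open>The three alternatives are the cases \<open>\<bar>j\<bar>\<close> = 0, 1, 2. The
    lower bounds make \<open>e\<close> nonzero, so its divisor \<open>n\<close> is at most
    \<open>\<bar>e\<bar>\<close>.\<close>
  then have e: "\<bar>e\<bar> \<le> 2 \<and> 1 \<le> \<bar>e\<bar> \<or> \<bar>e\<bar> \<le> int d + 1 \<and> int d - 1 \<le> \<bar>e\<bar> \<or>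
      \<bar>e\<bar> = 2 * int d \<and> \<bar>j\<bar> = 2 \<and> i = 0"
  proof (elim disjE conjE)
    assume "j = 0" "\<bar>i\<bar> \<le> 2"
    then show ?thesis using ij by (simp add: e_def) linarith
  next
    assume "\<bar>j\<bar> = 1" "\<bar>i\<bar> \<le> 1"
    then have "j = 1 \<or> j = -1" by linarith
    then show ?thesis using \<open>\<bar>i\<bar> \<le> 1\<close> unfolding e_def by (elim disjE) (simp, linarith)+
  next
    assume "\<bar>j\<bar> = 2" "i = 0"
    then show ?thesis by (simp add: e_def abs_mult)
  qed
  then have "e \<noteq> 0" using assms(1) by auto
  then have "int n \<le> \<bar>e\<bar>" using dvd_imp_le_int[OF _ dvd] by simp
  \<comment> \<open>Since \<open>d \<ge> 2\<close>, both 2 and \<open>d + 1\<close> are smaller than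
    \<open>2 * d \<le> n\<close>, which leaves only the last alternative.\<close>
  then have "\<bar>e\<bar> = 2 * int d \<and> \<bar>j\<bar> = 2 \<and> i = 0"
    using e assms(1,2) by linarith
  with \<open>int n \<le> \<bar>e\<bar>\<close> have n: "n = 2 * d" and "\<bar>j\<bar> = 2" "i = 0"
    using assms(2) by auto
  then obtain s where s: "s = 1 \<or> s = -1" "b' = b + 2 * s" "a' = a"
    unfolding i_def j_def using that[of 1] that[of "-1"] by linarith
  \<comment> \<open>A point within distance 1 of two points that lie two apart in a column is their
    midpoint.\<close>
  obtain p q where w: "w = (p, q)" by (cases w)
  have "\<bar>a - p\<bar> + \<bar>b - q\<bar> \<le> 1" "\<bar>a - p\<bar> + \<bar>b + 2 * s - q\<bar> \<le> 1"
    using assms(5,6) unfolding u v w s(2,3) by (simp_all add: closed_nbhd_square_grid)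
  then have "p = a" "q = b + s" using s(1) by linarith+
  then show thesis using that[of s a b] n s u v w by simp
qed

text \<open>This settles the case of equal images for all three kinds of code: a nonempty difference
  is what self-identification asks for, and it implies that the identifying sets differ.\<close>

lemma identifying_set_diff_same_image:
  assumes "d \<ge> 2" "2 * d \<le> n" and "u \<noteq> v"
    and same: "grid_to_circulant n d u = grid_to_circulant n d v"
    and ne: "identifying_set (circulant n {1, d}) C (grid_to_circulant n d u) \<noteq> {}"
  defines "C' \<equiv> grid_to_circulant n d -` C"
  shows "identifying_set square_grid C' u - identifying_set square_grid C' v \<noteq> {}"
proof -
  have "n > 0" using assms(1,2) by simp
  then obtain w where w: "w \<in> identifying_set square_grid C' u"
    using ne grid_to_circulant_image_identifying_set[of n d C u] unfolding C'_def by blast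
  show ?thesis
  proof (cases "w \<in> closed_nbhd square_grid v")
    case False
    then show ?thesis using w by (auto simp: identifying_set_def)
  next
    case True
    from w have "w \<in> closed_nbhd square_grid u" by (simp add: identifying_set_def)
    then obtain x y s where *: "n = 2 * d" "s = 1 \<or> s = -1" "u = (x, y)" "v = (x, y + 2 * s)"
      "w = (x, y + s)"
      using vertical_if_common_neighbour[OF assms(1-3) same _ True] by metis
    \<comment> \<open>\<open>(x, y - s)\<close> is the reflection of \<open>w\<close> in
      \<open>u\<close>. The two points are two rows apart, so their values before reduction differ
      by \<open>2 * d = n\<close> up to sign.\<close>
    have "(x + int d * (y - s)) - (x + int d * (y + s)) = int n * (- s)"
      using *(1) by (simp add: algebra_simps)
    then have "int n dvd (x + int d * (y - s)) - (x + int d * (y + s))"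
      by simp
    then have "grid_to_circulant n d (x, y - s) = grid_to_circulant n d w"
      unfolding *(5) grid_to_circulant_simp by (simp only: mod_eq_dvd_iff)
    moreover have "grid_to_circulant n d w \<in> C"
      using w by (simp add: identifying_set_def C'_def)
    ultimately have "(x, y - s) \<in> C'" by (simp add: C'_def)
    \<comment> \<open>The reflected point is adjacent to \<open>u\<close> but at distance 3 from
      \<open>v\<close>.\<close>
    then have "(x, y - s) \<in> identifying_set square_grid C' u - identifying_set square_grid C' v"
      using *(2) unfolding *(3,4) by (auto simp: identifying_set_def closed_nbhd_square_grid)
    then show ?thesis by blast
  qed
qed

section \<open>Pulling back the three kinds of codes\<close>

lemma is_code_pullback:
  assumes "is_code (circulant n {1, d}) C"
  shows "is_code square_grid (grid_to_circulant n d -` C)"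
proof -
  obtain c where c: "c \<in> C" "0 \<le> c" "c < int n"
    using assms by (fastforce simp: is_code_def circulant_def)
  then have "(c, 0) \<in> grid_to_circulant n d -` C" by simp
  then have "grid_to_circulant n d -` C \<noteq> {}" by blast
  then show ?thesis by (simp add: is_code_def)
qed

lemma dominating_code_pullback:
  assumes "n > 0" "dominating_code (circulant n {1, d}) C"
  shows "dominating_code square_grid (grid_to_circulant n d -` C)"
  using assms is_code_pullback grid_to_circulant_in_verts[OF assms(1)]
    grid_to_circulant_image_identifying_set[OF assms(1), of d C]
  unfolding dominating_code_def by (metis image_is_empty)

text \<open>If two vertices have different images, equal identifying sets in the grid would map to
  equal identifying sets in the circulant graph.\<close>

lemma identifying_code_pullback:
  assumes "d \<ge> 2" "2 * d \<le> n" and C: "identifying_code (circulant n {1, d}) C"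
  shows "identifying_code square_grid (grid_to_circulant n d -` C)"
proof -
  have n: "n > 0" using assms by simp
  note V = grid_to_circulant_in_verts[OF n]
  have "identifying_set square_grid (grid_to_circulant n d -` C) u \<noteq>
      identifying_set square_grid (grid_to_circulant n d -` C) v" if "u \<noteq> v" for u v
  proof (cases "grid_to_circulant n d u = grid_to_circulant n d v")
    case True
    have "identifying_set (circulant n {1, d}) C (grid_to_circulant n d u) \<noteq> {}"
      using C V unfolding identifying_code_def dominating_code_def by blast
    from identifying_set_diff_same_image[OF assms(1,2) that True this]
    show ?thesis by blast
  next
    case False
    then show ?thesis
      using C V grid_to_circulant_image_identifying_set[OF n, of d C]
      unfolding identifying_code_def by metis
  qed
  then show ?thesis
    using C dominating_code_pullback[OF n] by (auto simp: identifying_code_def)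
qed

text \<open>Grid vertices outside the pulled-back code are exactly those with image outside
  \<open>C\<close>, so separation of non-codewords transfers as for identifying codes.\<close>

lemma locating_dominating_code_pullback:
  assumes "d \<ge> 2" "2 * d \<le> n" and C: "locating_dominating_code (circulant n {1, d}) C"
  shows "locating_dominating_code square_grid (grid_to_circulant n d -` C)"
proof -
  have n: "n > 0" using assms by simp
  note V = grid_to_circulant_in_verts[OF n]
  have "identifying_set square_grid (grid_to_circulant n d -` C) u \<noteq>
      identifying_set square_grid (grid_to_circulant n d -` C) v"
    if "u \<noteq> v" "grid_to_circulant n d u \<notin> C" "grid_to_circulant n d v \<notin> C" for u v
  proof (cases "grid_to_circulant n d u = grid_to_circulant n d v")
    case True
    have "identifying_set (circulant n {1, d}) C (grid_to_circulant n d u) \<noteq> {}"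
      using C V unfolding locating_dominating_code_def dominating_code_def by blast
    from identifying_set_diff_same_image[OF assms(1,2) that(1) True this]
    show ?thesis by blast
  next
    case False
    then show ?thesis
      using C V that(2,3) grid_to_circulant_image_identifying_set[OF n, of d C]
      unfolding locating_dominating_code_def by (metis DiffI)
  qed
  then show ?thesis
    using C dominating_code_pullback[OF n] by (auto simp: locating_dominating_code_def)
qed

lemma self_identifying_code_pullback:
  assumes "d \<ge> 2" "2 * d \<le> n" and C: "self_identifying_code (circulant n {1, d}) C"
  shows "self_identifying_code square_grid (grid_to_circulant n d -` C)"
proof -
  have n: "n > 0" using assms by simp
  note V = grid_to_circulant_in_verts[OF n]
  have "identifying_set square_grid (grid_to_circulant n d -` C) u -
      identifying_set square_grid (grid_to_circulant n d -` C) v \<noteq> {}" if "u \<noteq> v" for u v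
  proof (cases "grid_to_circulant n d u = grid_to_circulant n d v")
    case True
    \<comment> \<open>\<open>self_identifying_code\<close> does not list domination; comparison with
      any second vertex \<open>z\<close> shows that the identifying set is nonempty.\<close>
    have "0 \<in> verts (circulant n {1, d})" "1 \<in> verts (circulant n {1, d})"
      using assms by (auto simp: circulant_def)
    then obtain z where "z \<in> verts (circulant n {1, d})" "grid_to_circulant n d u \<noteq> z"
      by (metis zero_neq_one)
    then have "identifying_set (circulant n {1, d}) C (grid_to_circulant n d u) \<noteq> {}"
      using C V[of d u "{1, d}"] unfolding self_identifying_code_def by blast
    from identifying_set_diff_same_image[OF assms(1,2) that True this]
    show ?thesis .
  next
    case False
    then have "identifying_set (circulant n {1, d}) C (grid_to_circulant n d u) -
        identifying_set (circulant n {1, d}) C (grid_to_circulant n d v) \<noteq> {}"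
      using C V unfolding self_identifying_code_def by blast
    \<comment> \<open>A grid codeword in the identifying set of \<open>u\<close> lying over an
      element of this difference cannot belong to the identifying set of \<open>v\<close>.\<close>
    then show ?thesis
      unfolding grid_to_circulant_image_identifying_set[OF n, symmetric] by blast
  qed
  then show ?thesis
    using C is_code_pullback by (auto simp: self_identifying_code_def)
qed

section \<open>Counting codewords and the density\<close>

lemma card_mod_preimage_window:
  fixes a :: int
  assumes "n > 0" "C \<subseteq> {0..<int n}"
  shows "card {x \<in> {a..<a + int n}. x mod int n \<in> C} = card C"
proof (rule bij_betw_same_card[of "\<lambda>x. x mod int n"], rule bij_betw_imageI)
  show "inj_on (\<lambda>x. x mod int n) {x \<in> {a..<a + int n}. x mod int n \<in> C}"
  proof (rule inj_onI)
    fix x y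
    assume *: "x \<in> {x \<in> {a..<a + int n}. x mod int n \<in> C}"
      "y \<in> {x \<in> {a..<a + int n}. x mod int n \<in> C}" "x mod int n = y mod int n"
    then have "int n dvd x - y" by (simp add: mod_eq_dvd_iff)
    moreover have "\<bar>x - y\<bar> < int n" using * by auto
    ultimately show "x = y" using dvd_imp_le_int[of "x - y" "int n"] by linarith
  qed
  show "(\<lambda>x. x mod int n) ` {x \<in> {a..<a + int n}. x mod int n \<in> C} = C"
  proof (intro equalityI subsetI)
    fix c assume c: "c \<in> C"
    \<comment> \<open>The representative of the residue class of \<open>c\<close> in the window
      starting at \<open>a\<close>.\<close>
    let ?x = "a + (c - a) mod int n"
    have "?x mod int n = c mod int n" by (simp add: mod_simps)
    also have "\<dots> = c" using c assms(2) by (intro mod_pos_pos_trivial) auto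
    finally have "?x mod int n = c" .
    moreover have "?x \<in> {a..<a + int n}" using assms by simp
    ultimately show "c \<in> (\<lambda>x. x mod int n) ` {x \<in> {a..<a + int n}. x mod int n \<in> C}"
      using c by (intro image_eqI[of _ _ ?x]) auto
  qed auto
qed

lemma card_mod_preimage_windows:
  fixes a :: int
  assumes "n > 0" "C \<subseteq> {0..<int n}"
  shows "card {x \<in> {a..<a + int (q * n)}. x mod int n \<in> C} = q * card C"
proof (induction q)
  case (Suc q)
  let ?b = "a + int (q * n)"
  have fin: "finite {x \<in> {b..<c}. x mod int n \<in> C}" for b c :: int
    by (rule finite_subset[of _ "{b..<c}"]) auto
  have "{x \<in> {a..<a + int (Suc q * n)}. x mod int n \<in> C} =
      {x \<in> {a..<?b}. x mod int n \<in> C} \<union> {x \<in> {?b..<?b + int n}. x mod int n \<in> C}"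
    using of_nat_0_le_iff[of "q * n", where 'a = int]
    by (simp only: set_eq_iff mem_Collect_eq Un_iff atLeastLessThan_iff mult_Suc of_nat_add) linarith
  moreover have "{x \<in> {a..<?b}. x mod int n \<in> C} \<inter> {x \<in> {?b..<?b + int n}. x mod int n \<in> C} = {}"
    by auto
  ultimately show ?case
    using Suc card_mod_preimage_window[OF assms, of ?b] fin
    by (simp only: card_Un_disjoint mult_Suc add.commute)
qed simp

text \<open>The interval contains \<open>L div n\<close> full windows and is contained in one more.
  Both the count and its expected value therefore lie between the same two consecutive multiples of
  \<open>card C\<close>. The error bound depends neither on \<open>a\<close> nor on
  \<open>L\<close>.\<close>

lemma card_mod_preimage_interval:
  fixes a :: int
  assumes "n > 0" "C \<subseteq> {0..<int n}"
  shows "\<bar>real (card {x \<in> {a..<a + int L}. x mod int n \<in> C}) - real (card C) / real n * real L\<bar>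
    \<le> real (card C)"
proof -
  let ?S = "\<lambda>L. {x \<in> {a..<a + int L}. x mod int n \<in> C}"
  let ?q = "L div n"
  have mono: "card (?S K) \<le> card (?S M)" if "K \<le> M" for K M
    using that by (intro card_mono finite_subset[of "?S M" "{a..<a + int M}"]) auto
  have L: "?q * n \<le> L" "L < Suc ?q * n"
    using assms(1) by (simp_all add: dividend_less_div_times)
  have "?q * card C \<le> card (?S L)"
    using mono[OF L(1)] unfolding card_mod_preimage_windows[OF assms] .
  moreover have "card (?S L) \<le> Suc ?q * card C"
    using mono[OF less_imp_le[OF L(2)]] unfolding card_mod_preimage_windows[OF assms] .
  ultimately have card: "real ?q * real (card C) \<le> real (card (?S L))"
    "real (card (?S L)) \<le> (real ?q + 1) * real (card C)"
    by (simp_all flip: of_nat_mult of_nat_Suc add: add.commute del: mult_Suc)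
  have "real (?q * n) \<le> real L" "real L \<le> real (Suc ?q * n)"
    using L by (auto simp del: of_nat_mult mult_Suc)
  then have "real ?q \<le> real L / real n" "real L / real n \<le> real ?q + 1"
    using assms(1) by (simp_all add: field_simps)
  then have "real ?q * real (card C) \<le> real L / real n * real (card C)"
    "real L / real n * real (card C) \<le> (real ?q + 1) * real (card C)"
    by (intro mult_right_mono; simp)+
  with card show ?thesis by (simp add: algebra_simps abs_le_iff)
qed

text \<open>Each of the \<open>2 * m + 1\<close> rows contributes an error of at most
  \<open>card C\<close>, so the total error is linear in \<open>m\<close> while the box grows
  quadratically.\<close>

lemma card_pullback_grid_box:
  assumes "n > 0" "C \<subseteq> {0..<int n}"
  shows "\<bar>real (card ((grid_to_circulant n d -` C) \<inter> grid_box m)) -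
      real (card C) / real n * (2 * real m + 1)\<^sup>2\<bar> \<le> real (card C) * (2 * real m + 1)"
proof -
  define L where "L = 2 * m + 1"
  define R where "R y = {x \<in> {- int m..int m}. (x + int d * y) mod int n \<in> C}" for y
  \<comment> \<open>The coordinates are swapped so that the dependent sum runs over the rows
    \<open>y\<close>.\<close>
  have "(grid_to_circulant n d -` C) \<inter> grid_box m =
      (\<lambda>(y, x). (x, y)) ` (SIGMA y:{- int m..int m}. R y)"
    by (force simp: grid_box_def R_def)
  then have "card ((grid_to_circulant n d -` C) \<inter> grid_box m) =
      card (SIGMA y:{- int m..int m}. R y)"
    by (simp add: card_image inj_on_def)
  also have "\<dots> = (\<Sum>y\<in>{- int m..int m}. card (R y))"
    by (rule card_SigmaI) (auto simp: R_def intro: finite_subset[of _ "{- int m..int m}"])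
  finally have total: "real (card ((grid_to_circulant n d -` C) \<inter> grid_box m)) =
      (\<Sum>y\<in>{- int m..int m}. real (card (R y)))"
    by simp
  have row: "\<bar>real (card (R y)) - real (card C) / real n * real L\<bar> \<le> real (card C)" for y
  proof -
    \<comment> \<open>Translation by \<open>d * y\<close> turns the condition on row
      \<open>y\<close> into one on residues in an interval of length \<open>L\<close> starting at
      \<open>?a\<close>.\<close>
    let ?a = "- int m + int d * y"
    have "{x \<in> {?a..<?a + int L}. x mod int n \<in> C} = (\<lambda>x. x + int d * y) ` R y"
    proof (intro equalityI subsetI)
      fix x assume "x \<in> {x \<in> {?a..<?a + int L}. x mod int n \<in> C}"
      then have "x - int d * y \<in> R y" by (auto simp: R_def L_def)
      then show "x \<in> (\<lambda>x. x + int d * y) ` R y" by force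
    qed (auto simp: R_def L_def)
    then have "card (R y) = card {x \<in> {?a..<?a + int L}. x mod int n \<in> C}"
      by (simp add: card_image)
    then show ?thesis
      using card_mod_preimage_interval[OF assms, of ?a L] by simp
  qed
  have rows: "card {- int m..int m} = L"
    by (simp add: L_def)
  have "\<bar>\<Sum>y\<in>{- int m..int m}. real (card (R y)) - real (card C) / real n * real L\<bar>
      \<le> (\<Sum>y\<in>{- int m..int m}. real (card C))"
    by (rule order_trans[OF sum_abs sum_mono]) (rule row)
  then have "\<bar>(\<Sum>y\<in>{- int m..int m}. real (card (R y))) - real L * (real (card C) / real n * real L)\<bar>
      \<le> real L * real (card C)"
    by (simp only: sum_subtractf sum_constant rows)
  moreover have "real L = 2 * real m + 1"
    by (simp add: L_def)
  ultimately show ?thesis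
    unfolding total by (simp add: power2_eq_square mult_ac)
qed

lemma card_grid_box: "real (card (grid_box m)) = (2 * real m + 1)\<^sup>2"
proof -
  have "grid_box m = {- int m..int m} \<times> {- int m..int m}"
    by (auto simp: grid_box_def)
  then show ?thesis
    by (simp add: power2_eq_square card_cartesian_product)
qed

text \<open>Divided by the box size, the counting error is at most
  \<open>card C / (2 * m + 1)\<close>. The ratios thus converge, and their limsup is the
  limit.\<close>

lemma code_density_pullback:
  assumes "n > 0" "C \<subseteq> {0..<int n}"
  shows "code_density (grid_to_circulant n d -` C) = ereal (real (card C) / real n)"
proof -
  let ?r = "\<lambda>m. real (card ((grid_to_circulant n d -` C) \<inter> grid_box m)) / real (card (grid_box m))"
  have bound: "\<bar>?r m - real (card C) / real n\<bar> \<le> real (card C) / (2 * real m + 1)" for m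
  proof -
    let ?N = "real (card ((grid_to_circulant n d -` C) \<inter> grid_box m))"
    let ?L = "2 * real m + 1"
    have L: "?L > 0" by simp
    then have "?r m - real (card C) / real n = (?N - real (card C) / real n * ?L\<^sup>2) / ?L\<^sup>2"
      by (simp add: card_grid_box diff_divide_distrib)
    also have "\<bar>\<dots>\<bar> = \<bar>?N - real (card C) / real n * ?L\<^sup>2\<bar> / ?L\<^sup>2"
      by simp
    also have "\<dots> \<le> real (card C) * ?L / ?L\<^sup>2"
      by (intro divide_right_mono card_pullback_grid_box assms) simp
    also have "\<dots> = real (card C) / ?L"
      using L by (simp add: power2_eq_square)
    finally show ?thesis .
  qed
  have null: "(\<lambda>m. real (card C) / (2 * real m + 1)) \<longlonglongrightarrow> 0"
    unfolding add.commute[of _ "1::real"]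
    by (intro tendsto_divide_0[OF tendsto_const] filterlim_at_top_imp_at_infinity
        filterlim_tendsto_add_at_top[OF tendsto_const]
        filterlim_tendsto_pos_mult_at_top[OF tendsto_const] filterlim_real_sequentially) auto
  have "(\<lambda>m. ?r m - real (card C) / real n) \<longlonglongrightarrow> 0"
    by (rule Lim_null_comparison[OF always_eventually null]) (simp only: real_norm_def bound simp_thms)
  then have "?r \<longlonglongrightarrow> real (card C) / real n"
    by (simp only: LIM_zero_iff)
  then have "(\<lambda>m. ereal (?r m)) \<longlonglongrightarrow> ereal (real (card C) / real n)"
    by simp
  then show ?thesis
    unfolding code_density_def by (intro lim_imp_Limsup) auto
qed

theorem theorem1:
  fixes n d k :: nat
  assumes "n > 0" and "k > 0" and "d \<ge> 2" and "real d \<le> real n / 2"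
  shows "(\<forall>C. identifying_code (circulant n {1, d}) C \<and> card C = k \<longrightarrow>
            (\<exists>C'. identifying_code square_grid C' \<and> code_density C' = ereal (real k / real n)))
       \<and> (\<forall>C. locating_dominating_code (circulant n {1, d}) C \<and> card C = k \<longrightarrow>
            (\<exists>C'. locating_dominating_code square_grid C' \<and> code_density C' = ereal (real k / real n)))
       \<and> (\<forall>C. self_identifying_code (circulant n {1, d}) C \<and> card C = k \<longrightarrow>
            (\<exists>C'. self_identifying_code square_grid C' \<and> code_density C' = ereal (real k / real n)))"
proof -
  have d: "2 * d \<le> n" using assms(4) by linarith
  have density: "code_density (grid_to_circulant n d -` C) = ereal (real (card C) / real n)"
    if "is_code (circulant n {1, d}) C" for C
    using that code_density_pullback[OF assms(1)] by (simp add: is_code_def circulant_def)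
  have codes: "is_code (circulant n {1, d}) C"
    if "identifying_code (circulant n {1, d}) C \<or> locating_dominating_code (circulant n {1, d}) C
      \<or> self_identifying_code (circulant n {1, d}) C" for C
    using that unfolding identifying_code_def locating_dominating_code_def
      self_identifying_code_def dominating_code_def by blast
  \<comment> \<open>In all three cases the witness is the preimage of \<open>C\<close> under
    \<open>grid_to_circulant n d\<close>.\<close>
  show ?thesis
    using identifying_code_pullback[OF assms(3) d] locating_dominating_code_pullback[OF assms(3) d]
      self_identifying_code_pullback[OF assms(3) d] density codes by metis
qed

end
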